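(* Let $d,r\ge1$, let $\lambda$ be a partition with $dr$ boxes and at most $\min(d^2,r^2)$ rows, and let $\delta=(d,\dots,d)$ ($r$ parts). Then $t^\lambda_{\delta,\delta}>0$.
   Context: $\alpha^T$ denotes the vector of column lengths of a partition $\alpha$. For finite $P\subseteq\mathbb{N}^3$ the marginals are $(x_P,y_P,z_P)$ with $x_P(i)$ the number of points of $P$ with $x$-coordinate $i$, etc.; $t^\lambda_{\mu,\pi}$ is the number of finite $P\subseteq\mathbb{N}^3$ with marginals $(\lambda^T,\mu^T,\pi^T)$. *)

theory Defs
  imports Main
begin

(* A partition is the list of its nonzero row lengths, so that "length" is the number of
   rows and "sum_list" the number of boxes. *)
definition is_partition :: "nat list \<Rightarrow> bool" where
  "is_partition \<alpha> \<longleftrightarrow> sorted_wrt (\<ge>) \<alpha> \<and> 0 \<notin> set \<alpha>"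

(* The column lengths of a partition.  Columns are numbered from 0, like the coordinates
   of points below, and the vector is padded with zeros to a function on all of nat. *)
definition column_lengths :: "nat list \<Rightarrow> nat \<Rightarrow> nat" where
  "column_lengths \<alpha> i = card {j. j < length \<alpha> \<and> i < \<alpha> ! j}"

definition x_marginal :: "(nat \<times> nat \<times> nat) set \<Rightarrow> nat \<Rightarrow> nat" where
  "x_marginal P i = card {(x, y, z). (x, y, z) \<in> P \<and> x = i}"

definition y_marginal :: "(nat \<times> nat \<times> nat) set \<Rightarrow> nat \<Rightarrow> nat" where
  "y_marginal P i = card {(x, y, z). (x, y, z) \<in> P \<and> y = i}"

definition z_marginal :: "(nat \<times> nat \<times> nat) set \<Rightarrow> nat \<Rightarrow> nat" where
  "z_marginal P i = card {(x, y, z). (x, y, z) \<in> P \<and> z = i}"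

(* The partition written as a superscript of t is the first argument. *)
definition t_number :: "nat list \<Rightarrow> nat list \<Rightarrow> nat list \<Rightarrow> nat" where
  "t_number lam mu pi = card {P. finite P
      \<and> x_marginal P = column_lengths lam
      \<and> y_marginal P = column_lengths mu
      \<and> z_marginal P = column_lengths pi}"

text \<open>The set counted by \<^const>\<open>t_number\<close> is always finite, so the cardinality is the
  genuine number of point sets.\<close>

lemma column_lengths_eq_0:
  assumes "sum_list \<alpha> \<le> i"
  shows "column_lengths \<alpha> i = 0"
proof -
  have "\<alpha> ! j \<le> i" if "j < length \<alpha>" for j
    using member_le_sum_list[OF nth_mem[OF that]] assms by linarith
  then have "{j. j < length \<alpha> \<and> i < \<alpha> ! j} = {}"
    using not_less by blast
  then show ?thesis
    by (simp add: column_lengths_def)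
qed

lemma finite_t_number_set:
  "finite {P. finite P
      \<and> x_marginal P = column_lengths lam
      \<and> y_marginal P = column_lengths mu
      \<and> z_marginal P = column_lengths pi}" (is "finite ?S")
proof (rule finite_subset)
  let ?B = "{..<sum_list lam} \<times> {..<sum_list mu} \<times> {..<sum_list pi}"
  show "finite (Pow ?B)"
    by simp
  show "?S \<subseteq> Pow ?B"
  proof (intro subsetI PowI)
    fix P and p :: "nat \<times> nat \<times> nat"
    assume P: "P \<in> ?S" and p: "p \<in> P"
    obtain x y z where xyz: "p = (x, y, z)"
      by (cases p)
    have fin: "finite {(x, y, z). (x, y, z) \<in> P \<and> Q x y z}" for Q
      by (rule finite_subset[of _ P]) (use P in auto)
    have "x_marginal P x \<noteq> 0" "y_marginal P y \<noteq> 0" "z_marginal P z \<noteq> 0"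
      using p unfolding x_marginal_def y_marginal_def z_marginal_def xyz
      by (auto simp: card_eq_0_iff fin)
    then have "column_lengths lam x \<noteq> 0" "column_lengths mu y \<noteq> 0" "column_lengths pi z \<noteq> 0"
      using P by auto
    then have "x < sum_list lam" "y < sum_list mu" "z < sum_list pi"
      using column_lengths_eq_0 not_less by blast+
    then show "p \<in> ?B"
      by (simp add: xyz)
  qed
qed

end

theory Submission imports Defs begin

text \<open>Let \<open>c\<^sub>0, c\<^sub>1, \<dots>\<close> be the column lengths of \<open>lam\<close>. Cut \<open>{0..<d * r}\<close> into consecutive
  intervals of lengths \<open>c\<^sub>0, c\<^sub>1, \<dots>\<close> and map a number \<open>k\<close> in the \<open>i\<close>-th interval to the point
  \<open>(i, k mod d, (k + k div d) mod d)\<close>. Each block of \<open>d\<close> consecutive numbers starting at a multiple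
  of \<open>d\<close> meets every value of the second and of the third coordinate once, so these marginals are
  constantly \<open>r\<close>. The last two coordinates determine \<open>k\<close> modulo \<open>d\<^sup>2\<close>, and every interval has at
  most \<open>d\<^sup>2\<close> elements, so the map is injective.\<close>

lemma column_lengths_replicate: "column_lengths (replicate r d) i = (if i < d then r else 0)"
  by (auto simp: column_lengths_def cong: conj_cong)

lemma column_lengths_le_length: "column_lengths \<alpha> i \<le> length \<alpha>"
  unfolding column_lengths_def
  by (rule order.trans[OF card_mono[of "{..<length \<alpha>}"]]) auto

text \<open>Double counting of the boxes, by columns and by rows. The number of boxes serves as
  summation bound because no row is longer, so all nonempty columns are included.\<close>

lemma sum_column_lengths: "(\<Sum>i<sum_list \<alpha>. column_lengths \<alpha> i) = sum_list \<alpha>"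
proof -
  have "(\<Sum>i<sum_list \<alpha>. column_lengths \<alpha> i)
      = (\<Sum>i<sum_list \<alpha>. \<Sum>j<length \<alpha>. if i < \<alpha> ! j then 1 else 0)"
    unfolding column_lengths_def
    by (intro sum.cong refl) (simp add: sum.If_cases Int_def)
  also have "\<dots> = (\<Sum>j<length \<alpha>. \<Sum>i<sum_list \<alpha>. if i < \<alpha> ! j then 1 else 0)"
    by (rule sum.swap)
  also have "\<dots> = (\<Sum>j<length \<alpha>. \<alpha> ! j)"
  proof (rule sum.cong[OF refl])
    fix j assume "j \<in> {..<length \<alpha>}"
    then have "\<alpha> ! j \<le> sum_list \<alpha>"
      by (simp add: member_le_sum_list)
    then have "{..<sum_list \<alpha>} \<inter> {i. i < \<alpha> ! j} = {..<\<alpha> ! j}"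
      by auto
    then show "(\<Sum>i<sum_list \<alpha>. if i < \<alpha> ! j then 1 else 0) = \<alpha> ! j"
      by (simp add: sum.If_cases)
  qed
  also have "\<dots> = sum_list \<alpha>"
    by (simp add: sum_list_sum_nth atLeast0LessThan)
  finally show ?thesis .
qed

text \<open>Partial sums of \<open>c\<close> cut \<open>{0..<n}\<close> into consecutive intervals,
  and \<open>g\<close> names the interval of \<open>k\<close>. The second property keeps what
  injectivity later needs: two numbers of one interval differ by less than its length.\<close>

lemma card_interval_colouring:
  fixes c :: "nat \<Rightarrow> nat"
  assumes "(\<Sum>i<N. c i) = n" and "\<And>i. N \<le> i \<Longrightarrow> c i = 0"
  obtains g where "\<And>i. card {k. k < n \<and> g k = i} = c i"
    and "\<And>k l. \<lbrakk>k < n; l < n; g k = g l; k \<le> l\<rbrakk> \<Longrightarrow> l < k + c (g k)"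
proof -
  define S where "S m = (\<Sum>i<m. c i)" for m
  \<comment> \<open>Taking the least index skips empty intervals, where \<open>c i = 0\<close> and
    \<open>S (Suc i) = S i\<close>.\<close>
  define g where "g k = (LEAST i. k < S (Suc i))" for k
  have S_Suc: "S (Suc i) = S i + c i" for i
    by (simp add: S_def)
  have S_mono: "S i \<le> S j" if "i \<le> j" for i j
    unfolding S_def by (rule sum_mono2) (use that in auto)
  have S_le: "S m \<le> n" for m
  proof (cases "m \<le> N")
    case True
    then show ?thesis using S_mono[of m N] assms(1) by (simp add: S_def)
  next
    case False
    then have "S m = S N"
      unfolding S_def by (intro sum.mono_neutral_right) (auto simp: assms(2))
    then show ?thesis using assms(1) by (simp add: S_def)
  qed
  have g_iff: "g k = i \<longleftrightarrow> S i \<le> k \<and> k < S (Suc i)" if "k < n" for k i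
  proof
    assume g: "g k = i"
    \<comment> \<open>The index \<open>N\<close> witnesses that the \<open>LEAST\<close> ranges over
      a nonempty set.\<close>
    have "k < S (Suc N)"
      using that assms(1) by (simp add: S_def)
    then have upper: "k < S (Suc i)"
      unfolding g[symmetric] g_def by (rule LeastI)
    have "S i \<le> k"
    proof (cases i)
      case 0
      then show ?thesis by (simp add: S_def)
    next
      case (Suc j)
      then have "\<not> k < S (Suc j)"
        using g unfolding g_def by (intro not_less_Least) simp
      then show ?thesis using Suc by simp
    qed
    with upper show "S i \<le> k \<and> k < S (Suc i)" by simp
  next
    assume k: "S i \<le> k \<and> k < S (Suc i)"
    show "g k = i"
      unfolding g_def
    proof (rule Least_equality)
      show "i \<le> j" if "k < S (Suc j)" for j
        using k that S_mono[of "Suc j" i] by (meson leD leI le_trans Suc_leI)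
    qed (use k in simp)
  qed
  show ?thesis
  proof
    show "card {k. k < n \<and> g k = i} = c i" for i
    proof -
      have "{k. k < n \<and> g k = i} = {S i..<S (Suc i)}"
        using g_iff[of _ i] less_le_trans[OF _ S_le[of "Suc i"]]
        unfolding set_eq_iff mem_Collect_eq atLeastLessThan_iff by blast
      then show ?thesis by (simp add: S_Suc)
    qed
    show "l < k + c (g k)" if "k < n" "l < n" "g k = g l" "k \<le> l" for k l
    proof -
      have "S (g k) \<le> k" "l < S (Suc (g k))"
        using that g_iff by metis+
      then show ?thesis by (simp add: S_Suc)
    qed
  qed
qed

text \<open>Inside a block of constant \<open>k div d\<close> the shift \<open>a * (k div d)\<close>
  is constant, so each residue occurs exactly once; hence \<open>k div d\<close> matches the
  solutions with the \<open>r\<close> blocks. The parameter \<open>a\<close> covers the second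
  coordinate (\<open>a = 0\<close>) and the third (\<open>a = 1\<close>).\<close>

lemma card_twisted_residue:
  fixes d :: nat
  assumes "y < d"
  shows "card {k. k < d * r \<and> (k + a * (k div d)) mod d = y} = r"
proof -
  let ?A = "{k. k < d * r \<and> (k + a * (k div d)) mod d = y}"
  have d: "0 < d" using assms by simp
  have "bij_betw (\<lambda>k. k div d) ?A {..<r}"
    unfolding bij_betw_def
  proof
    show "inj_on (\<lambda>k. k div d) ?A"
    proof (rule inj_onI)
      fix k l assume k: "k \<in> ?A" and l: "l \<in> ?A" and eq: "k div d = l div d"
      have "(k + a * (k div d)) mod d = (l + a * (k div d)) mod d"
        using k l eq by simp
      then have "k mod d = l mod d"
        by (simp add: nat_mod_eq_iff algebra_simps)
      with eq show "k = l"
        by (metis div_mult_mod_eq)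
    qed
    show "(\<lambda>k. k div d) ` ?A = {..<r}"
    proof (intro equalityI subsetI)
      fix q assume "q \<in> (\<lambda>k. k div d) ` ?A"
      then show "q \<in> {..<r}"
        by (auto simp: less_mult_imp_div_less mult.commute)
    next
      fix q assume q: "q \<in> {..<r}"
      \<comment> \<open>This is \<open>y - a * q\<close> modulo \<open>d\<close>, with the factor -1
        replaced by \<open>d - 1\<close> to stay in the naturals.\<close>
      define s where "s = (y + (d - 1) * (a * q)) mod d"
      have s: "s < d" using d by (simp add: s_def)
      have "(s + a * q) mod d = (y + ((d - 1) * (a * q) + a * q)) mod d"
        unfolding s_def by (simp add: mod_add_left_eq add.assoc)
      also have "(d - 1) * (a * q) + a * q = d * (a * q)"
        using d by (cases d) simp_all
      also have "(y + d * (a * q)) mod d = y"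
        using assms by simp
      finally have "(d * q + s + a * q) mod d = y"
        by (simp add: add.assoc)
      moreover have "d * q + s < d * r"
      proof -
        have "d * q + s < d * Suc q" using s by simp
        also have "\<dots> \<le> d * r" using q by (intro mult_le_mono2) auto
        finally show ?thesis .
      qed
      moreover have "(d * q + s) div d = q"
        using s d by simp
      ultimately show "q \<in> (\<lambda>k. k div d) ` ?A"
        by (intro image_eqI[of _ _ "d * q + s"]) simp_all
    qed
  qed
  then show ?thesis
    using bij_betw_same_card by fastforce
qed

text \<open>Write \<open>l = k + d * m\<close>. The quotient by \<open>d\<close> then grows by
  \<open>m\<close>, so the second congruence forces \<open>d dvd m\<close>, while the distance bound
  gives \<open>m < d\<close>; thus \<open>m = 0\<close>.\<close>

lemma twisted_residues_determine:
  fixes d :: nat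
  assumes "k mod d = l mod d" and "(k + k div d) mod d = (l + l div d) mod d"
    and "k \<le> l" and "l < k + d\<^sup>2"
  shows "k = l"
proof -
  have d: "0 < d" using assms(3,4) by (cases "d = 0") auto
  have "d dvd l - k"
    using assms(1,3) by (metis mod_eq_dvd_iff_nat)
  then obtain m where m: "l = k + d * m"
    using assms(3) by (metis dvdE le_add_diff_inverse)
  have "l div d = k div d + m"
    using m d by simp
  then have "(k + k div d) mod d = (k + k div d + m + d * m) mod d"
    using assms(2) m by (simp add: algebra_simps)
  then have "(k + k div d) mod d = (k + k div d + m) mod d"
    by simp
  then have "d dvd (k + k div d + m) - (k + k div d)"
    by (metis mod_eq_dvd_iff_nat le_add1)
  then have "d dvd m"
    by simp
  moreover have "m < d"
    using assms(4) m by (simp add: power2_eq_square)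
  ultimately show ?thesis
    using m by (auto dest: dvd_imp_le)
qed

lemma marginals_image:
  fixes f g h :: "nat \<Rightarrow> nat" and n :: nat
  assumes "inj_on (\<lambda>k. (f k, g k, h k)) {..<n}"
  defines "P \<equiv> (\<lambda>k. (f k, g k, h k)) ` {..<n}"
  shows "x_marginal P i = card {k. k < n \<and> f k = i}"
    and "y_marginal P i = card {k. k < n \<and> g k = i}"
    and "z_marginal P i = card {k. k < n \<and> h k = i}"
proof -
  let ?F = "\<lambda>k. (f k, g k, h k)"
  have card_image_F: "card (?F ` {k. k < n \<and> Q k}) = card {k. k < n \<and> Q k}" for Q
    by (rule card_image) (auto intro: inj_on_subset[OF assms(1)])
  have "{(x, y, z). (x, y, z) \<in> P \<and> x = i} = ?F ` {k. k < n \<and> f k = i}"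
    and "{(x, y, z). (x, y, z) \<in> P \<and> y = i} = ?F ` {k. k < n \<and> g k = i}"
    and "{(x, y, z). (x, y, z) \<in> P \<and> z = i} = ?F ` {k. k < n \<and> h k = i}"
    by (auto simp: P_def)
  then show "x_marginal P i = card {k. k < n \<and> f k = i}"
    and "y_marginal P i = card {k. k < n \<and> g k = i}"
    and "z_marginal P i = card {k. k < n \<and> h k = i}"
    by (simp_all only: x_marginal_def y_marginal_def z_marginal_def card_image_F)
qed

theorem theorem6p9:
  fixes d r :: nat and lam :: "nat list"
  assumes "d \<ge> 1" and "r \<ge> 1"
    and "is_partition lam" and "sum_list lam = d * r"
    and "length lam \<le> min (d^2) (r^2)"
  shows "t_number lam (replicate r d) (replicate r d) > 0"
proof -
  \<comment> \<open>Here \<open>d * r\<close> is both the number of boxes and a bound beyond which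
    all columns are empty.\<close>
  have "(\<Sum>i<d * r. column_lengths lam i) = d * r"
    using sum_column_lengths[of lam] assms(4) by simp
  moreover have "column_lengths lam i = 0" if "d * r \<le> i" for i
    using column_lengths_eq_0 that assms(4) by simp
  ultimately obtain f
    where card_f: "\<And>i. card {k. k < d * r \<and> f k = i} = column_lengths lam i"
      and f_close: "\<And>k l. \<lbrakk>k < d * r; l < d * r; f k = f l; k \<le> l\<rbrakk>
        \<Longrightarrow> l < k + column_lengths lam (f k)"
    using card_interval_colouring by blast
  define g where "g k = k mod d" for k
  define h where "h k = (k + k div d) mod d" for k
  define P where "P = (\<lambda>k. (f k, g k, h k)) ` {..<d * r}"
  have "k = l" if "k < d * r" "l < d * r" "k \<le> l" "f k = f l" "g k = g l" "h k = h l" for k l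
  proof (rule twisted_residues_determine)
    \<comment> \<open>A column has at most one box per row, so the bound on the rows bounds every
      interval length.\<close>
    have "column_lengths lam (f k) \<le> d\<^sup>2"
      using column_lengths_le_length[of lam "f k"] assms(5) by simp
    then show "l < k + d\<^sup>2"
      using f_close[of k l] that by simp
  qed (use that in \<open>simp_all add: g_def h_def\<close>)
  then have inj: "inj_on (\<lambda>k. (f k, g k, h k)) {..<d * r}"
    by (intro linorder_inj_onI) fastforce+
  have residues: "card {k. k < d * r \<and> (k + a * (k div d)) mod d = i}
      = column_lengths (replicate r d) i" for a i
  proof (cases "i < d")
    case True
    then show ?thesis
      by (simp add: column_lengths_replicate card_twisted_residue)
  next
    case False
    then have "(k + a * (k div d)) mod d \<noteq> i" for k
      using assms(1) mod_less_divisor[of d "k + a * (k div d)"] by linarith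
    then show ?thesis
      using False by (simp add: column_lengths_replicate)
  qed
  have "x_marginal P = column_lengths lam"
    using marginals_image(1)[OF inj] card_f by (auto simp: P_def)
  moreover have "y_marginal P = column_lengths (replicate r d)"
    using marginals_image(2)[OF inj] residues[of 0] by (auto simp: P_def g_def)
  moreover have "z_marginal P = column_lengths (replicate r d)"
    using marginals_image(3)[OF inj] residues[of 1] by (auto simp: P_def h_def)
  moreover have "finite P"
    by (simp add: P_def)
  \<comment> \<open>Finiteness of the counted family matters, since \<open>card\<close> of an
    infinite set is 0; \<open>P\<close> shows that the family is nonempty.\<close>
  ultimately show ?thesis
    unfolding t_number_def card_gt_0_iff using finite_t_number_set by blast
qed

end
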